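(* Let $\phi:[1,+\infty)\to\mathbb R_+$ be increasing and twice differentiable with $\limsup_{t\to+\infty}\frac{t\phi''(t)}{\phi'(t)}<-2$. Then there exist no cutoff sequence $S\in[1,+\infty)^{\mathbb N}$ and constant $C>0$ such that, for every distribution $p$ of the running time $T\in[1,+\infty]$, $\mathcal{L}_p(S)\leq C\,\mu_\phi(T)$.
   Context: Restart setup: a Las Vegas algorithm has random running time $T\in[1,+\infty]$ with distribution $p$. Given a cutoff sequence $S\in[1,+\infty)^{\mathbb N}$, the multi-start algorithm runs the algorithm successively with cutoffs $S_0,S_1,\dots$; at round $k$ a fresh copy with running time $T_k$ is run for at most $S_k$, where $T_0,T_1,\dots$ are i.i.d. with distribution $p$; it stops at $K^\star=\min\{k\geq0:T_k\leq S_k\}$, and $\mathcal{L}_p(S)=\mathbb{E}\big[\sum_{k=0}^{K^\star-1}S_k+T_{K^\star}\big]$. For a positive, continuous, increasing $\phi$, $\mu_\phi(T)=\phi^{-1}(\mathbb{E}[\phi(T)])$, where $\phi(+\infty)=\lim_{t\to+\infty}\phi(t)$ and $\mu_\phi(T)=+\infty$ if $\mathbb{E}[\phi(T)]$ is not attained by $\phi$ on $[1,+\infty)$. *)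

theory Defs
  imports "HOL-Probability.Probability"
begin

definition running_time_dist :: "ennreal measure \<Rightarrow> bool" where
  "running_time_dist p \<longleftrightarrow> prob_space p \<and> sets p = sets borel \<and> (AE T in p. 1 \<le> T)"

(* If no round succeeds, K* is infinite and every round k is run for its full cutoff S k. *)
definition multi_start_time :: "(nat \<Rightarrow> real) \<Rightarrow> (nat \<Rightarrow> ennreal) \<Rightarrow> ennreal" where
  "multi_start_time S T =
     (if \<exists>k. T k \<le> ennreal (S k)
      then (let K = (LEAST k. T k \<le> ennreal (S k)) in (\<Sum>k<K. ennreal (S k)) + T K)
      else (\<Sum>k. ennreal (S k)))"

(* The product measure makes the coordinates T 0, T 1, ... i.i.d. with distribution p. *)
definition multi_start_cost :: "ennreal measure \<Rightarrow> (nat \<Rightarrow> real) \<Rightarrow> ennreal" where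
  "multi_start_cost p S = (\<integral>\<^sup>+ T. multi_start_time S T \<partial>(\<Pi>\<^sub>M k\<in>(UNIV :: nat set). p))"

definition extend_infty :: "(real \<Rightarrow> real) \<Rightarrow> ennreal \<Rightarrow> ennreal" where
  "extend_infty \<phi> x =
     (if x = \<infinity> then Lim at_top (\<lambda>t. ennreal (\<phi> t)) else ennreal (\<phi> (enn2real x)))"

(* The mean depends on T only through its distribution p, and on \<phi> only through its values
   on [1, \<infinity>). It is meant for \<phi> nonnegative and strictly increasing there. *)
definition phi_mean :: "(real \<Rightarrow> real) \<Rightarrow> ennreal measure \<Rightarrow> ennreal" where
  "phi_mean \<phi> p =
     (let m = (\<integral>\<^sup>+ T. extend_infty \<phi> T \<partial>p)
      in if m \<in> (\<lambda>t. ennreal (\<phi> t)) ` {1..}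
         then ennreal (inv_into {1..} (\<lambda>t. ennreal (\<phi> t)) m)
         else \<infinity>)"

end

theory Submission
  imports Defs "HOL-Real_Asymp.Real_Asymp"
begin

text \<open>
  Since \<open>t \<phi>'' / \<phi>' \<le> - c\<close> eventually for some \<open>c > 2\<close>, the function
  \<open>\<phi>'(t) t\<^sup>c\<close> is eventually decreasing, so \<open>\<phi>\<close> has a finite limit \<open>L\<close> and
  \<open>t (L - \<phi> t) \<longrightarrow> 0\<close>. Let \<open>T\<close> be \<open>1\<close> with probability \<open>1/(2n)\<close> and \<open>\<infinity>\<close>
  otherwise. Whatever the cutoffs, the first \<open>n\<close> rounds all fail with probability at least
  \<open>1/2\<close>, so the cost is at least \<open>n/2\<close>. The mean \<open>\<mu>\<close> satisfies
  \<open>L - \<phi> \<mu> = (L - \<phi> 1)/(2n)\<close>, so a bound \<open>n/2 \<le> C \<mu>\<close> would keep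
  \<open>\<mu> (L - \<phi> \<mu>)\<close> away from \<open>0\<close> while \<open>\<mu> \<longrightarrow> \<infinity>\<close>.
\<close>

section \<open>Power-law decay of \<phi>' and the tail of \<phi>\<close>

lemma bounded_of_derivative_powr_decay:
  fixes f f' :: "real \<Rightarrow> real"
  assumes a: "a > 0" and c: "c > 1" and K: "K \<ge> 0"
    and deriv: "\<And>t. t \<ge> a \<Longrightarrow> (f has_real_derivative f' t) (at t)"
    and decay: "\<And>t. t \<ge> a \<Longrightarrow> f' t \<le> K * t powr (- c)"
    and st: "a \<le> t" "t \<le> s"
  shows "f s \<le> f t + K / (c - 1) * t powr (1 - c)"
proof -
  have "f s + K / (c - 1) * s powr (1 - c) \<le> f t + K / (c - 1) * t powr (1 - c)"
  proof (rule DERIV_nonpos_imp_nonincreasing[OF st(2)])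
    fix x assume x: "t \<le> x" "x \<le> s"
    have x0: "x > 0" using x st a by linarith
    have "((\<lambda>x. f x + K / (c - 1) * x powr (1 - c)) has_real_derivative
            f' x + K / (c - 1) * ((1 - c) * x powr (1 - c - 1))) (at x)"
      using x st x0 c by (auto intro!: derivative_eq_intros deriv)
    moreover have "K / (c - 1) * ((1 - c) * x powr (1 - c - 1)) = - (K * x powr (- c))"
      using c by (simp add: field_simps)
    moreover have "f' x \<le> K * x powr (- c)" using decay x st by auto
    ultimately show "\<exists>y. ((\<lambda>x. f x + K / (c - 1) * x powr (1 - c)) has_real_derivative y) (at x) \<and> y \<le> 0"
      by (metis add.commute add.right_inverse add_right_mono)
  qed
  moreover have "K / (c - 1) * s powr (1 - c) \<ge> 0" using K c by simp
  ultimately show ?thesis by linarith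
qed

text \<open>A Gronwall argument: \<open>log_deriv\<close> is the inequality that makes the
  derivative of \<open>f t * t powr c\<close> nonpositive.\<close>

lemma derivative_powr_decay:
  fixes f f' :: "real \<Rightarrow> real"
  assumes a: "a > 0"
    and deriv: "\<And>t. t \<ge> a \<Longrightarrow> (f has_real_derivative f' t) (at t)"
    and log_deriv: "\<And>t. t \<ge> a \<Longrightarrow> t * f' t \<le> - c * f t"
    and t: "a \<le> t"
  shows "f t \<le> f a * a powr c * t powr (- c)"
proof -
  have "f t * t powr c \<le> f a * a powr c"
  proof (rule DERIV_nonpos_imp_nonincreasing[OF t])
    fix x assume x: "a \<le> x" "x \<le> t"
    have x0: "x > 0" using x a by linarith
    have "((\<lambda>x. f x * x powr c) has_real_derivative
            f' x * x powr c + (c * x powr (c - 1)) * f x) (at x)"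
      using x x0 by (auto intro!: derivative_eq_intros deriv)
    moreover have "f' x * x powr c + (c * x powr (c - 1)) * f x = x powr (c - 1) * (x * f' x + c * f x)"
      using x0 by (simp add: powr_diff field_simps)
    moreover have "x powr (c - 1) * (x * f' x + c * f x) \<le> 0"
      using log_deriv[OF x(1)] by (intro mult_nonneg_nonpos) auto
    ultimately show "\<exists>y. ((\<lambda>x. f x * x powr c) has_real_derivative y) (at x) \<and> y \<le> 0"
      by metis
  qed
  then show ?thesis using t a by (simp add: powr_minus field_simps)
qed

text \<open>Integrating the decay of \<phi>' bounds \<open>L - \<phi> t\<close> by a multiple of
  \<open>t powr (1 - c)\<close>. An exponent \<open>c > 1\<close> already gives a finite limit;
  \<open>c > 2\<close> makes the gap to it negligible against \<open>1 / t\<close>.\<close>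

lemma limit_of_steep_function:
  fixes \<phi> \<phi>' \<phi>'' :: "real \<Rightarrow> real"
  assumes increasing: "strict_mono_on {1..} \<phi>"
    and deriv1: "\<And>t. t \<ge> 1 \<Longrightarrow> (\<phi> has_real_derivative \<phi>' t) (at t within {1..})"
    and deriv2: "\<And>t. t \<ge> 1 \<Longrightarrow> (\<phi>' has_real_derivative \<phi>'' t) (at t within {1..})"
    and limsup: "Limsup at_top (\<lambda>t. ereal (t * \<phi>'' t / \<phi>' t)) < - 2"
  obtains L where "(\<phi> \<longlongrightarrow> L) at_top" and "\<And>t. t \<ge> 1 \<Longrightarrow> \<phi> t < L"
    and "((\<lambda>t. t * (L - \<phi> t)) \<longlongrightarrow> 0) at_top"
proof -
  \<comment> \<open>Room between the limsup and -2 keeps \<open>c = - d\<close> strictly above 2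
    after passing to an eventual bound.\<close>
  obtain d where d: "Limsup at_top (\<lambda>t. ereal (t * \<phi>'' t / \<phi>' t)) < ereal d" "ereal d < - 2"
    using ereal_dense2[OF limsup] by auto
  define c where "c = - d"
  have c: "c > 2"
  proof -
    have "ereal d < ereal (- 2)" using d(2) by simp
    then show ?thesis by (simp add: c_def del: uminus_ereal.simps)
  qed
  have "eventually (\<lambda>t. t * \<phi>'' t / \<phi>' t < d) at_top"
    using Limsup_lessD[OF d(1)] by simp
  then obtain a0 where a0: "\<And>t. t \<ge> a0 \<Longrightarrow> t * \<phi>'' t / \<phi>' t < d"
    by (auto simp: eventually_at_top_linorder)
  \<comment> \<open>From 2 on every point is interior to \<open>{1..}\<close>, so derivatives within
    \<open>{1..}\<close> become full derivatives.\<close>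
  define a where "a = max a0 2"
  have within: "at t within {1..} = at t" if "t \<ge> a" for t :: real
    using that by (intro at_within_interior) (auto simp: a_def)
  have D1: "(\<phi> has_real_derivative \<phi>' t) (at t)" if "t \<ge> a" for t
    using deriv1[of t] within[OF that] that by (simp add: a_def)
  have D2: "(\<phi>' has_real_derivative \<phi>'' t) (at t)" if "t \<ge> a" for t
    using deriv2[of t] within[OF that] that by (simp add: a_def)
  have mono: "\<phi> s \<le> \<phi> t" if "1 \<le> s" "s \<le> t" for s t
    using strict_mono_on_leD[OF increasing] that by auto
  have pos: "\<phi>' t > 0" if t: "t \<ge> a" for t
  proof -
    have "\<phi>' t \<ge> 0"
      by (rule mono_on_imp_deriv_nonneg[of "{1..}" \<phi>, OF _ D1[OF t]])
        (use t mono in \<open>auto simp: a_def mono_on_def\<close>)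
    \<comment> \<open>Division by zero yields 0, which is not below the negative
      \<open>d\<close>.\<close>
    moreover have "\<phi>' t \<noteq> 0" using a0[of t] t c by (auto simp: a_def c_def)
    ultimately show ?thesis by simp
  qed
  have decay: "\<phi>' t \<le> \<phi>' a * a powr c * t powr (- c)" if t: "t \<ge> a" for t
  proof (rule derivative_powr_decay[OF _ D2 _ t])
    show "s * \<phi>'' s \<le> - c * \<phi>' s" if s: "s \<ge> a" for s
      using a0[of s] pos[OF s] s by (auto simp: a_def c_def field_simps)
  qed (auto simp: a_def)
  define M where "M = \<phi>' a * a powr c / (c - 1)"
  have tail: "\<phi> s \<le> \<phi> t + M * t powr (1 - c)" if "a \<le> t" "t \<le> s" for s t
    unfolding M_def
    by (rule bounded_of_derivative_powr_decay[OF _ _ _ D1 decay that])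
      (use c pos[of a] in \<open>auto simp: a_def\<close>)
  \<comment> \<open>Monotonicity extends the bound to \<open>s < t\<close>, so that the supremum
    over all of \<open>{1..}\<close> can be taken.\<close>
  have tail': "\<phi> s \<le> \<phi> t + M * t powr (1 - c)" if "a \<le> t" "1 \<le> s" for s t
    using tail[OF that(1), of "max s t"] mono[of s "max s t"] that by auto
  define L where "L = (SUP t\<in>{1..}. \<phi> t)"
  have bdd: "bdd_above (\<phi> ` {1..})"
    using tail'[of a] by (auto intro!: bdd_aboveI2)
  have le: "\<phi> t \<le> L" if "t \<ge> 1" for t
    unfolding L_def using bdd that by (intro cSUP_upper) auto
  have less: "\<phi> t < L" if "t \<ge> 1" for t
    using le[of "t + 1"] strict_mono_onD[OF increasing, of t "t + 1"] that by auto
  have L_le: "L \<le> \<phi> t + M * t powr (1 - c)" if "a \<le> t" for t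
    unfolding L_def using tail'[OF that] by (intro cSUP_least) auto
  have lim: "(\<phi> \<longlongrightarrow> L) at_top"
  proof (rule order_tendstoI)
    fix y assume "y < L"
    then obtain t where t: "t \<ge> 1" "y < \<phi> t"
      unfolding L_def using bdd by (subst (asm) less_cSUP_iff) auto
    then have "\<forall>s\<ge>t. y < \<phi> s" using mono by fastforce
    then show "eventually (\<lambda>s. y < \<phi> s) at_top" by (auto simp: eventually_at_top_linorder)
  next
    fix y assume "L < y"
    then have "\<forall>s\<ge>1. \<phi> s < y" using le by fastforce
    then show "eventually (\<lambda>s. \<phi> s < y) at_top" by (auto simp: eventually_at_top_linorder)
  qed
  have "((\<lambda>t. t * (L - \<phi> t)) \<longlongrightarrow> 0) at_top"
  proof (rule tendsto_sandwich[of "\<lambda>_. 0" _ _ "\<lambda>t. M * (t * t powr (1 - c))"])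
    show "eventually (\<lambda>t. 0 \<le> t * (L - \<phi> t)) at_top"
      using eventually_ge_at_top[of 1] by eventually_elim (use le in auto)
    show "eventually (\<lambda>t. t * (L - \<phi> t) \<le> M * (t * t powr (1 - c))) at_top"
      using eventually_ge_at_top[of a]
    proof eventually_elim
      case (elim t)
      then have "t * (L - \<phi> t) \<le> t * (M * t powr (1 - c))"
        using L_le[OF elim] by (intro mult_left_mono) (auto simp: a_def)
      then show ?case by (simp add: mult.left_commute)
    qed
    \<comment> \<open>The product is \<open>t powr (2 - c)\<close> for positive \<open>t\<close>;
      this is where \<open>c > 2\<close> enters.\<close>
    have "((\<lambda>t. t * t powr (1 - c)) \<longlongrightarrow> 0) at_top" using c by real_asymp
    then show "((\<lambda>t. M * (t * t powr (1 - c))) \<longlongrightarrow> 0) at_top"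
      by (rule tendsto_mult_right_zero)
  qed simp
  with lim less show ?thesis by (rule that)
qed

section \<open>Cost of rounds that hang\<close>

text \<open>An infinite running time exceeds every cutoff, so a first success can occur only at an
  index \<open>K \<ge> n\<close>, and each failed round costs at least 1. Without any success all
  cutoffs are paid.\<close>

lemma multi_start_time_ge:
  assumes S: "\<And>k. S k \<ge> 1" and T: "\<And>k. k < n \<Longrightarrow> T k = \<infinity>"
  shows "of_nat n \<le> multi_start_time S T"
proof -
  have partial: "of_nat n \<le> (\<Sum>k<m. ennreal (S k))" if "n \<le> m" for m
  proof -
    have "(\<Sum>k<m. 1 :: ennreal) \<le> (\<Sum>k<m. ennreal (S k))"
      using S by (intro sum_mono) simp
    moreover have "(of_nat n :: ennreal) \<le> of_nat m" using that by simp
    ultimately show ?thesis by (simp del: of_nat_le_iff)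
  qed
  show ?thesis
  proof (cases "\<exists>k. T k \<le> ennreal (S k)")
    case True
    define K where "K = (LEAST k. T k \<le> ennreal (S k))"
    have "T K \<le> ennreal (S K)" unfolding K_def using True by (rule LeastI_ex)
    then have "n \<le> K" using T[of K] by (cases "K < n") (auto simp: top_unique)
    then have "of_nat n \<le> (\<Sum>k<K. ennreal (S k)) + T K"
      using partial by (meson add_increasing2 zero_le)
    then show ?thesis using True by (simp add: multi_start_time_def K_def Let_def)
  next
    case False
    have "of_nat n \<le> (\<Sum>k<n. ennreal (S k))" by (rule partial) simp
    also have "\<dots> \<le> (\<Sum>k. ennreal (S k))" by (rule sum_le_suminf) auto
    finally show ?thesis using False by (simp add: multi_start_time_def)
  qed
qed

text \<open>Only the event that the first \<open>n\<close> runs hang is counted; its probability is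
  a power by independence.\<close>

lemma multi_start_cost_ge:
  assumes p: "running_time_dist p" and S: "\<And>k. S k \<ge> 1"
  shows "of_nat n * emeasure p {\<infinity>} ^ n \<le> multi_start_cost p S"
proof -
  interpret prob_space p using p by (simp add: running_time_dist_def)
  interpret P: product_prob_space "\<lambda>_. p" "UNIV :: nat set" by unfold_locales
  have sets: "sets p = sets borel" using p by (simp add: running_time_dist_def)
  then have space: "space p = UNIV" using sets_eq_imp_space_eq by fastforce
  have sing: "{\<infinity>} \<in> sets p" using sets by simp
  \<comment> \<open>A cylinder over \<open>n\<close> coordinates, whose measure is a finite
    product.\<close>
  define A where "A = prod_emb UNIV (\<lambda>_. p) {..<n} (\<Pi>\<^sub>E k\<in>{..<n}. {\<infinity>})"
  have A: "emeasure (\<Pi>\<^sub>M k\<in>(UNIV :: nat set). p) A = emeasure p {\<infinity>} ^ n"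
    unfolding A_def using sing by (subst P.emeasure_PiM_emb) auto
  have A_sets: "A \<in> sets (\<Pi>\<^sub>M k\<in>(UNIV :: nat set). p)"
    unfolding A_def using sing by (intro sets_PiM_I) auto
  have "of_nat n * emeasure p {\<infinity>} ^ n
      = (\<integral>\<^sup>+ T. of_nat n * indicator A T \<partial>(\<Pi>\<^sub>M k\<in>(UNIV :: nat set). p))"
    using A A_sets by (simp add: nn_integral_cmult_indicator)
  also have "\<dots> \<le> multi_start_cost p S"
    unfolding multi_start_cost_def
  proof (rule nn_integral_mono)
    fix T :: "nat \<Rightarrow> ennreal"
    show "of_nat n * indicator A T \<le> multi_start_time S T"
    proof (cases "T \<in> A")
      case True
      then have restr: "restrict T {..<n} \<in> (\<Pi>\<^sub>E k\<in>{..<n}. {\<infinity>})"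
        by (simp add: A_def prod_emb_def)
      have "T k = \<infinity>" if "k < n" for k
        using PiE_mem[OF restr, of k] that by (simp only: lessThan_iff restrict_apply' singleton_iff)
      then show ?thesis using multi_start_time_ge[of S n T, OF S] True by simp
    qed simp
  qed
  finally show ?thesis .
qed

section \<open>The two-point running time\<close>

text \<open>For \<open>q\<close> in \<open>[0, 1]\<close>, every finite cutoff that is at least 1
  succeeds with the same probability \<open>q\<close>, so no choice of cutoffs can help.\<close>

definition finish_or_hang :: "real \<Rightarrow> ennreal measure" where
  "finish_or_hang q = distr (measure_pmf (bernoulli_pmf q)) borel (\<lambda>b. if b then 1 else \<infinity>)"

lemma running_time_dist_finish_or_hang: "running_time_dist (finish_or_hang q)"
proof -
  have "prob_space (finish_or_hang q)"
    unfolding finish_or_hang_def by (rule measure_pmf.prob_space_distr) simp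
  moreover have "AE T in finish_or_hang q. 1 \<le> T"
    unfolding finish_or_hang_def by (subst AE_distr_iff) auto
  moreover have "sets (finish_or_hang q) = sets borel" by (simp add: finish_or_hang_def)
  ultimately show ?thesis by (simp add: running_time_dist_def)
qed

(* g need not be measurable, so nn_integral_distr cannot be applied to it directly *)
lemma nn_integral_finish_or_hang:
  assumes "0 \<le> q" "q \<le> 1"
  shows "(\<integral>\<^sup>+ T. g T \<partial>finish_or_hang q) = ennreal q * g 1 + ennreal (1 - q) * g \<infinity>"
proof -
  let ?h = "\<lambda>T :: ennreal. g 1 * indicator {1} T + g \<infinity> * indicator {\<infinity>} T"
  have "(\<integral>\<^sup>+ T. g T \<partial>finish_or_hang q) = (\<integral>\<^sup>+ T. ?h T \<partial>finish_or_hang q)"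
  proof (rule nn_integral_cong_AE)
    have "AE T in finish_or_hang q. T = 1 \<or> T = \<infinity>"
      unfolding finish_or_hang_def by (subst AE_distr_iff) auto
    then show "AE T in finish_or_hang q. g T = ?h T"
      by eventually_elim auto
  qed
  also have "\<dots> = ennreal q * g 1 + ennreal (1 - q) * g \<infinity>"
    unfolding finish_or_hang_def using assms
    by (subst nn_integral_distr) (auto simp: nn_integral_bernoulli_pmf mult.commute)
  finally show ?thesis .
qed

lemma emeasure_finish_or_hang_infinity:
  assumes "0 \<le> q" "q \<le> 1"
  shows "emeasure (finish_or_hang q) {\<infinity>} = ennreal (1 - q)"
proof -
  have "emeasure (finish_or_hang q) {\<infinity>} = (\<integral>\<^sup>+ T. indicator {\<infinity>} T \<partial>finish_or_hang q)"
    by (rule nn_integral_indicator[symmetric]) (simp add: finish_or_hang_def)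
  then show ?thesis using nn_integral_finish_or_hang[OF assms, of "indicator {\<infinity>}"] by simp
qed

text \<open>The expectation \<open>m\<close> is a convex combination of \<open>\<phi> 1\<close> and
  \<open>L\<close> with positive weight on \<open>\<phi> 1\<close>. It therefore lies in
  \<open>[\<phi> 1, L)\<close> and is attained by continuity, so the mean is finite even when runs
  may hang.\<close>

lemma phi_mean_finish_or_hang:
  fixes \<phi> :: "real \<Rightarrow> real"
  assumes nonneg: "\<And>t. t \<ge> 1 \<Longrightarrow> \<phi> t \<ge> 0" and cont: "continuous_on {1..} \<phi>"
    and lim: "(\<phi> \<longlongrightarrow> L) at_top" and less: "\<phi> 1 < L"
    and q: "0 < q" "q \<le> 1"
  obtains \<mu> where "\<mu> \<ge> 1" and "phi_mean \<phi> (finish_or_hang q) = ennreal \<mu>"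
    and "L - \<phi> \<mu> = q * (L - \<phi> 1)"
proof -
  define m where "m = q * \<phi> 1 + (1 - q) * L"
  have m_ge: "\<phi> 1 \<le> m"
    using mult_left_mono[of "\<phi> 1" L "1 - q"] less q by (simp add: m_def algebra_simps)
  have "m < L"
    using mult_strict_left_mono[OF less q(1)] by (simp add: m_def algebra_simps)
  then have "eventually (\<lambda>t. m < \<phi> t \<and> 1 \<le> t) at_top"
    using order_tendstoD(1)[OF lim] eventually_ge_at_top[of 1] by (auto intro: eventually_conj)
  then obtain b where b: "m < \<phi> b" "1 \<le> b"
    using eventually_happens[of _ "at_top :: real filter"] by fastforce
  obtain x where x: "x \<ge> 1" "\<phi> x = m"
    using IVT'[of \<phi> 1 m b] m_ge b continuous_on_subset[OF cont, of "{1..b}"] by force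
  have "((\<lambda>t. ennreal (\<phi> t)) \<longlongrightarrow> ennreal L) at_top"
    using lim by (rule tendsto_ennrealI)
  then have Lim: "Lim at_top (\<lambda>t. ennreal (\<phi> t)) = ennreal L"
    by (rule tendsto_Lim[OF trivial_limit_at_top_linorder])
  have int: "(\<integral>\<^sup>+ T. extend_infty \<phi> T \<partial>finish_or_hang q) = ennreal m"
    using nonneg[of 1] less q nn_integral_finish_or_hang[of q "extend_infty \<phi>"]
    by (simp add: extend_infty_def Lim m_def ennreal_mult ennreal_plus)
  \<comment> \<open>The chosen preimage may differ from \<open>x\<close>; only its value under
    \<phi> matters.\<close>
  define \<mu> where "\<mu> = inv_into {1..} (\<lambda>t. ennreal (\<phi> t)) (ennreal m)"
  have img: "ennreal m \<in> (\<lambda>t. ennreal (\<phi> t)) ` {1..}" using x by (auto intro!: image_eqI[of _ _ x])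
  have mu_ge: "\<mu> \<ge> 1" using inv_into_into[OF img] by (simp add: \<mu>_def)
  have "ennreal (\<phi> \<mu>) = ennreal m" unfolding \<mu>_def by (rule f_inv_into_f[OF img])
  \<comment> \<open>\<open>ennreal\<close> collapses negative reals to 0, so it is cancelled using
    that both sides are nonnegative.\<close>
  then have "\<phi> \<mu> = m" using nonneg[OF mu_ge] nonneg[of 1] m_ge by simp
  then have "L - \<phi> \<mu> = q * (L - \<phi> 1)" by (simp add: m_def algebra_simps)
  moreover have "phi_mean \<phi> (finish_or_hang q) = ennreal \<mu>"
    using img by (simp add: phi_mean_def int \<mu>_def)
  ultimately show ?thesis using mu_ge that by blast
qed

section \<open>Contradiction for arbitrary cutoffs\<close>

theorem theorem6:
  fixes \<phi> \<phi>' \<phi>'' :: "real \<Rightarrow> real"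
  assumes nonneg: "\<And>t. t \<ge> 1 \<Longrightarrow> \<phi> t \<ge> 0"
    and increasing: "strict_mono_on {1..} \<phi>"
    and deriv1: "\<And>t. t \<ge> 1 \<Longrightarrow> (\<phi> has_real_derivative \<phi>' t) (at t within {1..})"
    and deriv2: "\<And>t. t \<ge> 1 \<Longrightarrow> (\<phi>' has_real_derivative \<phi>'' t) (at t within {1..})"
    and limsup: "Limsup at_top (\<lambda>t. ereal (t * \<phi>'' t / \<phi>' t)) < - 2"
  shows "\<not> (\<exists>(S :: nat \<Rightarrow> real) (C :: real).
            (\<forall>k. S k \<ge> 1) \<and> C > 0 \<and>
            (\<forall>p. running_time_dist p \<longrightarrow> multi_start_cost p S \<le> ennreal C * phi_mean \<phi> p))"
proof
  assume "\<exists>(S :: nat \<Rightarrow> real) (C :: real).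
            (\<forall>k. S k \<ge> 1) \<and> C > 0 \<and>
            (\<forall>p. running_time_dist p \<longrightarrow> multi_start_cost p S \<le> ennreal C * phi_mean \<phi> p)"
  then obtain S :: "nat \<Rightarrow> real" and C :: real where S: "\<And>k. S k \<ge> 1" and C: "C > 0"
    and cost: "\<And>p. running_time_dist p \<Longrightarrow> multi_start_cost p S \<le> ennreal C * phi_mean \<phi> p"
    by blast
  obtain L where lim: "(\<phi> \<longlongrightarrow> L) at_top" and less: "\<And>t. t \<ge> 1 \<Longrightarrow> \<phi> t < L"
    and decay: "((\<lambda>t. t * (L - \<phi> t)) \<longlongrightarrow> 0) at_top"
    using limit_of_steep_function[OF increasing deriv1 deriv2 limsup] by blast
  have cont: "continuous_on {1..} \<phi>"
    using deriv1 by (intro DERIV_continuous_on) auto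
  \<comment> \<open>The bounds \<open>n / 2 \<le> C * \<mu>\<close> and
    \<open>q = 1 / (2 * n)\<close> will give \<open>\<mu> * q \<ge> 1 / (4 * C)\<close>, hence this
    lower bound on \<open>\<mu> * (L - \<phi> \<mu>)\<close>.\<close>
  define \<epsilon> where "\<epsilon> = (L - \<phi> 1) / (4 * C)"
  have "\<epsilon> > 0" using less[of 1] C by (simp add: \<epsilon>_def)
  then obtain b where b: "\<And>t. t \<ge> b \<Longrightarrow> t * (L - \<phi> t) < \<epsilon>"
    using order_tendstoD(2)[OF decay] by (auto simp: eventually_at_top_linorder)
  \<comment> \<open>The size \<open>2 * C * b\<close> will force \<open>b \<le> \<mu>\<close>
    through \<open>n / 2 \<le> C * \<mu>\<close>.\<close>
  obtain n where n: "real n \<ge> max 1 (2 * C * b)" using real_arch_simple by blast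
  then have n_pos: "n > 0" by (cases n) auto
  \<comment> \<open>Chosen so that Bernoulli's inequality gives
    \<open>(1 - q) ^ n \<ge> 1 - n * q = 1 / 2\<close>.\<close>
  define q where "q = 1 / (2 * real n)"
  have q: "0 < q" "q \<le> 1" using n by (auto simp: q_def)
  obtain \<mu> where mu: "\<mu> \<ge> 1" "phi_mean \<phi> (finish_or_hang q) = ennreal \<mu>"
      "L - \<phi> \<mu> = q * (L - \<phi> 1)"
    using phi_mean_finish_or_hang[OF nonneg cont lim _ q] less by auto
  have "1 / 2 \<le> (1 - q) ^ n"
    using Bernoulli_inequality[of "- q" n] q n_pos by (simp add: q_def)
  then have "ennreal (real n / 2) \<le> ennreal (real n * (1 - q) ^ n)"
    by (intro ennreal_leI) (metis mult_left_mono of_nat_0_le_iff times_divide_eq_right mult.right_neutral)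
  also have "\<dots> = of_nat n * emeasure (finish_or_hang q) {\<infinity>} ^ n"
    unfolding emeasure_finish_or_hang_infinity[OF less_imp_le[OF q(1)] q(2)] using q
    by (simp add: ennreal_mult ennreal_power ennreal_of_nat_eq_real_of_nat)
  also have "\<dots> \<le> multi_start_cost (finish_or_hang q) S"
    by (rule multi_start_cost_ge[OF running_time_dist_finish_or_hang S])
  also have "\<dots> \<le> ennreal C * phi_mean \<phi> (finish_or_hang q)"
    by (rule cost[OF running_time_dist_finish_or_hang])
  also have "\<dots> = ennreal (C * \<mu>)" using mu C by (simp add: ennreal_mult)
  finally have bound: "real n / 2 \<le> C * \<mu>" using mu C by simp
  then have "2 * C * b \<le> 2 * C * \<mu>" using n by simp
  then have "b \<le> \<mu>" using C by simp
  then have "\<mu> * (q * (L - \<phi> 1)) < \<epsilon>" using b mu(3) by metis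
  moreover have "\<epsilon> \<le> \<mu> * (q * (L - \<phi> 1))"
  proof -
    have "1 / (4 * C) \<le> \<mu> * q" using bound C n_pos by (simp add: q_def field_simps)
    then have "1 / (4 * C) * (L - \<phi> 1) \<le> \<mu> * q * (L - \<phi> 1)"
      using less[of 1] by (intro mult_right_mono) auto
    then show ?thesis by (simp add: \<epsilon>_def mult.assoc)
  qed
  ultimately show False by simp
qed

end
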